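(* Let $(S,\leq)$ be an ordered ring and $R$ an $S$-pseudonormed ring. Assume that $S$ is dense and shrinkable and that $(S,\leq)$ is a join-semilattice. Then the following statements hold: (1) If $(x_n)$ and $(y_n)$ are sequences in $R$ convergent to $a$ and $b$ in $R$, respectively, then $(x_ny_n)$ is convergent to $ab$. (2) The set $\operatorname{Conv}(R)$ is a ring, and the function $\varphi:\operatorname{Conv}(R)\to R$ defined by $(x_n)\mapsto\lim_{n\to+\infty}x_n$ is a ring epimorphism with $\ker(\varphi)=\operatorname{Zero}(R)$. (3) Let $R$ be a commutative ring with $1$. The ideal $\operatorname{Zero}(R)$ of $\operatorname{Conv}(R)$ is prime (respectively maximal) if and only if $R$ is an integral domain (respectively a field).
   Context: $(H,+,\cdot,0,\leq)$ is an ordered hemiring if: $(H,+,0,\leq)$ is a commutative ordered monoid (a commutative monoid with a partial order $\leq$ compatible with $+$); $(H,\cdot)$ is a semigroup, and $a\leq b$, $0\leq c$ imply $ac\leq bc$ and $ca\leq cb$ for all $a,b,c\in H$; multiplication distributes over addition on both sides, and $0h=h0=0$ for all $h\in H$. An ordered ring is a ring that is an ordered hemiring. An element $a$ is positive if $a>0$. An ordered hemiring $H$ is dense if for any $\alpha>0$ in $H$ there are $\beta>0$ and $\gamma>0$ in $H$ with $\beta+\gamma<\alpha$. It is shrinkable if for any given positive $\alpha$ and $M$ in $H$ there are positive $\alpha_l,\alpha_r\in H$ with $M\alpha_r<\alpha$ and $\alpha_l M<\alpha$. A ring $R$ (not necessarily with identity) is an $S$-pseudonormed ring if it is equipped with a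 function $\Vert\cdot\Vert:R\to S$ such that for all $r,s\in R$: $\Vert r\Vert\geq 0$, and $\Vert r\Vert=0$ if and only if $r=0$; $\Vert r-s\Vert\leq\Vert r\Vert+\Vert s\Vert$; and $\Vert rs\Vert\leq\Vert r\Vert\,\Vert s\Vert$. A sequence $(x_n)$ in $R$ converges to $a\in R$ if for every positive $\epsilon\in S$ there is a natural number $N$ such that $n\geq N$ implies $\Vert x_n-a\Vert<\epsilon$. $\operatorname{Conv}(R)$ is the set of all convergent sequences in $R$ (with termwise addition and multiplication), and $\operatorname{Zero}(R)$ is the set of all sequences in $R$ convergent to $0$. *)

theory Defs
  imports "HOL-Algebra.QuotRing"
begin

(* Ordered hemirings are the types of class ordered_semiring_0 and ordered rings those of
   class ordered_ring: the order is partial, and there need be no multiplicative identity. *)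

definition dense_hemiring :: "'s::ordered_semiring_0 itself \<Rightarrow> bool" where
  "dense_hemiring _ \<longleftrightarrow>
     (\<forall>\<alpha>::'s. \<alpha> > 0 \<longrightarrow> (\<exists>\<beta> \<gamma>. \<beta> > 0 \<and> \<gamma> > 0 \<and> \<beta> + \<gamma> < \<alpha>))"

definition shrinkable_hemiring :: "'s::ordered_semiring_0 itself \<Rightarrow> bool" where
  "shrinkable_hemiring _ \<longleftrightarrow>
     (\<forall>(\<alpha>::'s) M. \<alpha> > 0 \<and> M > 0 \<longrightarrow>
        (\<exists>\<alpha>\<^sub>l \<alpha>\<^sub>r. \<alpha>\<^sub>l > 0 \<and> \<alpha>\<^sub>r > 0 \<and> M * \<alpha>\<^sub>r < \<alpha> \<and> \<alpha>\<^sub>l * M < \<alpha>))"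

(* The library locale ring demands an identity. Here, as in the notions built on it below,
   the field one of the record is unconstrained. *)
locale nonunital_ring = abelian_group R for R (structure) +
  assumes mult_closed: "\<lbrakk> x \<in> carrier R; y \<in> carrier R \<rbrakk> \<Longrightarrow> x \<otimes> y \<in> carrier R"
    and mult_assoc: "\<lbrakk> x \<in> carrier R; y \<in> carrier R; z \<in> carrier R \<rbrakk>
      \<Longrightarrow> (x \<otimes> y) \<otimes> z = x \<otimes> (y \<otimes> z)"
    and distrib_right: "\<lbrakk> x \<in> carrier R; y \<in> carrier R; z \<in> carrier R \<rbrakk>
      \<Longrightarrow> (x \<oplus> y) \<otimes> z = x \<otimes> z \<oplus> y \<otimes> z"
    and distrib_left: "\<lbrakk> x \<in> carrier R; y \<in> carrier R; z \<in> carrier R \<rbrakk>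
      \<Longrightarrow> z \<otimes> (x \<oplus> y) = z \<otimes> x \<oplus> z \<otimes> y"

lemma ring_iff_nonunital_ring: "ring R \<longleftrightarrow> nonunital_ring R \<and> monoid R"
  by (auto simp: ring_def ring_axioms_def nonunital_ring_def nonunital_ring_axioms_def
      monoid.m_closed monoid.m_assoc)

definition nonunital_ring_hom ::
    "('a, 'm) ring_scheme \<Rightarrow> ('b, 'n) ring_scheme \<Rightarrow> ('a \<Rightarrow> 'b) set" where
  "nonunital_ring_hom R S =
     {h. h \<in> carrier R \<rightarrow> carrier S \<and>
       (\<forall>x\<in>carrier R. \<forall>y\<in>carrier R.
          h (x \<oplus>\<^bsub>R\<^esub> y) = h x \<oplus>\<^bsub>S\<^esub> h y \<and> h (x \<otimes>\<^bsub>R\<^esub> y) = h x \<otimes>\<^bsub>S\<^esub> h y)}"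

definition nonunital_ring_epi ::
    "('a, 'm) ring_scheme \<Rightarrow> ('b, 'n) ring_scheme \<Rightarrow> ('a \<Rightarrow> 'b) set" where
  "nonunital_ring_epi R S = {h \<in> nonunital_ring_hom R S. h ` carrier R = carrier S}"

locale pseudonormed_ring = nonunital_ring R for R (structure) +
  fixes nrm :: "'a \<Rightarrow> 's::ordered_ring"
  assumes nrm_nonneg: "r \<in> carrier R \<Longrightarrow> 0 \<le> nrm r"
    and nrm_eq_zero_iff: "r \<in> carrier R \<Longrightarrow> nrm r = 0 \<longleftrightarrow> r = \<zero>"
    and nrm_diff: "\<lbrakk> r \<in> carrier R; s \<in> carrier R \<rbrakk> \<Longrightarrow> nrm (r \<ominus> s) \<le> nrm r + nrm s"
    and nrm_mult: "\<lbrakk> r \<in> carrier R; s \<in> carrier R \<rbrakk> \<Longrightarrow> nrm (r \<otimes> s) \<le> nrm r * nrm s"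

definition seq_converges ::
    "('a, 'm) ring_scheme \<Rightarrow> ('a \<Rightarrow> 's::ordered_ring) \<Rightarrow> (nat \<Rightarrow> 'a) \<Rightarrow> 'a \<Rightarrow> bool" where
  "seq_converges R nrm x a \<longleftrightarrow>
     (\<forall>n. x n \<in> carrier R) \<and> a \<in> carrier R \<and>
     (\<forall>\<epsilon>. \<epsilon> > 0 \<longrightarrow> (\<exists>N. \<forall>n\<ge>N. nrm (x n \<ominus>\<^bsub>R\<^esub> a) < \<epsilon>))"

definition Conv :: "('a, 'm) ring_scheme \<Rightarrow> ('a \<Rightarrow> 's::ordered_ring) \<Rightarrow> (nat \<Rightarrow> 'a) set" where
  "Conv R nrm = {x. \<exists>a. seq_converges R nrm x a}"

definition Zero_seqs :: "('a, 'm) ring_scheme \<Rightarrow> ('a \<Rightarrow> 's::ordered_ring) \<Rightarrow> (nat \<Rightarrow> 'a) set" where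
  "Zero_seqs R nrm = {x. seq_converges R nrm x \<zero>\<^bsub>R\<^esub>}"

definition Conv_ring :: "('a, 'm) ring_scheme \<Rightarrow> ('a \<Rightarrow> 's::ordered_ring) \<Rightarrow> (nat \<Rightarrow> 'a) ring" where
  "Conv_ring R nrm =
     \<lparr> carrier = Conv R nrm,
       mult = (\<lambda>x y n. x n \<otimes>\<^bsub>R\<^esub> y n),
       one = (\<lambda>n. \<one>\<^bsub>R\<^esub>),
       zero = (\<lambda>n. \<zero>\<^bsub>R\<^esub>),
       add = (\<lambda>x y n. x n \<oplus>\<^bsub>R\<^esub> y n) \<rparr>"

definition seq_lim :: "('a, 'm) ring_scheme \<Rightarrow> ('a \<Rightarrow> 's::ordered_ring) \<Rightarrow> (nat \<Rightarrow> 'a) \<Rightarrow> 'a" where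
  "seq_lim R nrm x = (THE a. seq_converges R nrm x a)"

end

theory Submission
  imports Defs
begin

text \<open>
  Write \<open>\<parallel>r\<parallel>\<close> for \<open>nrm r\<close>. Density plays the role of halving \<open>\<epsilon>\<close>: every
  positive \<open>\<epsilon>\<close> dominates a sum \<open>\<beta> + \<gamma>\<close> of positive elements, so two null terms can be added.
  This gives the limit of a difference, and also uniqueness of limits, since \<open>\<parallel>a - b\<parallel>\<close> lies
  strictly below every positive \<open>\<epsilon>\<close> and hence cannot be positive itself. Sums and opposites
  reduce to differences because constant sequences converge.

  For products, \<open>xy - ab = (x - a)y + a(y - b)\<close>. The order on \<open>S\<close> is only partial and
  multiplication only weakly monotone, so the argument needs positive upper bounds \<open>M\<close> for \<open>\<parallel>y\<^sub>n\<parallel>\<close>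
  and \<open>\<parallel>a\<parallel>\<close>; the given \<open>\<epsilon>\<close> provides them, as \<open>\<parallel>b\<parallel> + \<epsilon>\<close> (for all large \<open>n\<close>) and
  \<open>\<parallel>a\<parallel> + \<epsilon>\<close>. Shrinkability then replaces division by \<open>M\<close>.

  Consequently the limit is a well-defined homomorphism, it is onto because of the
  constant sequences, and its kernel consists by definition of the null sequences. When \<open>R\<close> is a
  commutative ring, so is \<open>Conv(R)\<close>, and the last claim is the general fact that the kernel of a
  surjective homomorphism is prime (maximal) exactly when the codomain is a domain (a field).
\<close>

section \<open>Kernels of surjective homomorphisms of commutative rings\<close>

text \<open>Together with the first isomorphism theorem, these two lemmas carry a property of a quotient
  over to the codomain of a surjective homomorphism. A ring isomorphism is required to preserve
  \<open>one\<close> but not explicitly \<open>zero\<close>; that it does is what identifies the image with \<open>S\<close>.\<close>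
lemma domain_ring_iso:
  assumes "domain R" "ring S" "R \<simeq> S"
  shows "domain S"
proof -
  obtain h where h: "h \<in> ring_iso R S"
    using assms(3) by (auto simp: is_ring_iso_def)
  have "ring R" using assms(1) by (simp add: domain_def cring_def)
  then have "h \<zero>\<^bsub>R\<^esub> = \<zero>\<^bsub>S\<^esub>"
    using h assms(2) ring_hom_zero by (fastforce simp: ring_iso_def)
  then show ?thesis
    using domain.ring_iso_imp_img_domain[OF assms(1) h] by simp
qed

lemma field_ring_iso:
  assumes "field R" "ring S" "R \<simeq> S"
  shows "field S"
proof -
  obtain h where h: "h \<in> ring_iso R S"
    using assms(3) by (auto simp: is_ring_iso_def)
  have "ring R" using assms(1) by (simp add: field_def domain_def cring_def)
  then have "h \<zero>\<^bsub>R\<^esub> = \<zero>\<^bsub>S\<^esub>"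
    using h assms(2) ring_hom_zero by (fastforce simp: ring_iso_def)
  then show ?thesis
    using field.ring_iso_imp_img_field[OF assms(1) h] by simp
qed

lemma (in ring_hom_cring) kernel_prime_iff_domain:
  assumes surj: "h ` carrier R = carrier S"
  shows "primeideal (a_kernel R S h) R \<longleftrightarrow> domain S"
proof -
  interpret K: ideal "a_kernel R S h" R by (rule ring.kernel_is_ideal)
  have iso: "R Quot a_kernel R S h \<simeq> S" by (rule ring.FactRing_iso[OF surj])
  have "domain (R Quot a_kernel R S h) \<longleftrightarrow> domain S"
    using domain_ring_iso[OF _ S.ring_axioms iso]
      domain_ring_iso[OF _ K.quotient_is_ring ring_iso_sym[OF K.quotient_is_ring iso]]
    by blast
  then show ?thesis
    using R.quot_domain_iff_primeideal[OF ring.kernel_is_ideal] by simp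
qed

text \<open>The quotient by a maximal ideal is a field, and it is isomorphic to \<open>S\<close>. Conversely, if \<open>S\<close>
  is a field then an ideal strictly containing the kernel has an element \<open>j\<close> with \<open>h j\<close> invertible. A preimage \<open>c\<close> of the inverse makes
  \<open>1 - c j\<close> lie in the kernel, so the ideal contains \<open>1\<close>.\<close>
lemma (in ring_hom_cring) kernel_maximal_iff_field:
  assumes surj: "h ` carrier R = carrier S"
  shows "maximalideal (a_kernel R S h) R \<longleftrightarrow> field S"
proof
  assume "maximalideal (a_kernel R S h) R"
  then have "field (R Quot a_kernel R S h)"
    by (rule maximalideal.quotient_is_field[OF _ R.is_cring])
  then show "field S"
    by (rule field_ring_iso[OF _ S.ring_axioms ring.FactRing_iso[OF surj]])
next
  assume field: "field S"
  have mem_kernel: "r \<in> a_kernel R S h \<longleftrightarrow> r \<in> carrier R \<and> h r = \<zero>\<^bsub>S\<^esub>" for r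
    unfolding a_kernel_def' by blast
  show "maximalideal (a_kernel R S h) R"
  proof (rule maximalidealI[OF ring.kernel_is_ideal])
    have "\<one> \<notin> a_kernel R S h"
      unfolding mem_kernel ring.hom_one
      using domain.one_not_zero[OF field.axioms(1)[OF field]] by blast
    then show "carrier R \<noteq> a_kernel R S h" by auto
  next
    fix J assume "ideal J R" and sub: "a_kernel R S h \<subseteq> J" and "J \<subseteq> carrier R"
    then interpret J: ideal J R by simp
    show "J = a_kernel R S h \<or> J = carrier R"
    proof (cases "J = a_kernel R S h")
      case False
      then obtain j where j: "j \<in> J" "j \<notin> a_kernel R S h" using sub by blast
      have jR: "j \<in> carrier R" using j \<open>J \<subseteq> carrier R\<close> by blast
      have "h j \<in> Units S"
        using j jR ring.hom_closed[OF jR] unfolding mem_kernel field.field_Units[OF field] by blast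
      then obtain c where c: "c \<in> carrier R" "h c \<otimes>\<^bsub>S\<^esub> h j = \<one>\<^bsub>S\<^esub>"
        using surj by (metis S.Units_l_inv S.Units_inv_closed imageE)
      have cj: "c \<otimes> j \<in> J" using c j by (simp add: J.I_l_closed)
      have "h (\<one> \<ominus> c \<otimes> j) = \<zero>\<^bsub>S\<^esub>" and "\<one> \<ominus> c \<otimes> j \<in> carrier R"
        using c jR by (simp_all add: R.minus_eq S.r_neg)
      then have "\<one> \<ominus> c \<otimes> j \<in> J"
        using sub mem_kernel by blast
      then have "(\<one> \<ominus> c \<otimes> j) \<oplus> c \<otimes> j \<in> J"
        using cj by (rule J.a_closed)
      moreover have "(\<one> \<ominus> c \<otimes> j) \<oplus> c \<otimes> j = \<one>"
        using c jR by (simp add: R.minus_eq R.a_assoc R.l_neg)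
      ultimately show ?thesis using J.one_imp_carrier by simp
    qed simp
  qed
qed

section \<open>Limits in pseudonormed rings\<close>

lemma (in nonunital_ring) diff_distrib_right:
  assumes "x \<in> carrier R" "y \<in> carrier R" "z \<in> carrier R"
  shows "(x \<ominus> y) \<otimes> z = x \<otimes> z \<ominus> y \<otimes> z"
proof -
  have "(x \<ominus> y) \<otimes> z \<oplus> y \<otimes> z = ((x \<ominus> y) \<oplus> y) \<otimes> z"
    using assms by (simp add: distrib_right)
  also have "(x \<ominus> y) \<oplus> y = x"
    using assms by (simp add: minus_eq a_assoc l_neg)
  finally have eq: "x \<otimes> z = (x \<ominus> y) \<otimes> z \<oplus> y \<otimes> z" by simp
  show ?thesis
    unfolding eq using assms by (simp add: mult_closed minus_eq a_assoc r_neg)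
qed

lemma (in nonunital_ring) diff_distrib_left:
  assumes "x \<in> carrier R" "y \<in> carrier R" "z \<in> carrier R"
  shows "z \<otimes> (x \<ominus> y) = z \<otimes> x \<ominus> z \<otimes> y"
proof -
  have "z \<otimes> (x \<ominus> y) \<oplus> z \<otimes> y = z \<otimes> ((x \<ominus> y) \<oplus> y)"
    using assms by (simp add: distrib_left)
  also have "(x \<ominus> y) \<oplus> y = x"
    using assms by (simp add: minus_eq a_assoc l_neg)
  finally have eq: "z \<otimes> x = z \<otimes> (x \<ominus> y) \<oplus> z \<otimes> y" by simp
  show ?thesis
    unfolding eq using assms by (simp add: mult_closed minus_eq a_assoc r_neg)
qed

context pseudonormed_ring
begin

lemma nrm_zero: "nrm \<zero> = 0"
  by (simp add: nrm_eq_zero_iff)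

lemma nrm_minus_le: "r \<in> carrier R \<Longrightarrow> nrm (\<ominus> r) \<le> nrm r"
  using nrm_diff[of \<zero> r] by (simp add: nrm_zero minus_eq)

lemma nrm_add:
  assumes "r \<in> carrier R" "s \<in> carrier R"
  shows "nrm (r \<oplus> s) \<le> nrm r + nrm s"
proof -
  have "nrm (r \<oplus> s) = nrm (r \<ominus> (\<ominus> s))"
    using assms by (simp add: minus_eq)
  also have "\<dots> \<le> nrm r + nrm (\<ominus> s)" using assms by (intro nrm_diff) auto
  also have "\<dots> \<le> nrm r + nrm s" using assms nrm_minus_le by (intro add_left_mono)
  finally show ?thesis .
qed

lemma seq_converges_const: "a \<in> carrier R \<Longrightarrow> seq_converges R nrm (\<lambda>n. a) a"
  by (simp add: seq_converges_def minus_eq r_neg nrm_zero)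

text \<open>The tolerances are separate because density and shrinkability deliver two unrelated positive
  elements.\<close>
lemma seq_converges_jointly:
  assumes "seq_converges R nrm x a" "seq_converges R nrm y b" "0 < \<beta>" "0 < \<gamma>"
  obtains N where "\<And>n. n \<ge> N \<Longrightarrow> nrm (x n \<ominus> a) < \<beta>" "\<And>n. n \<ge> N \<Longrightarrow> nrm (y n \<ominus> b) < \<gamma>"
proof -
  obtain N1 N2 where "\<forall>n\<ge>N1. nrm (x n \<ominus> a) < \<beta>" "\<forall>n\<ge>N2. nrm (y n \<ominus> b) < \<gamma>"
    using assms by (metis seq_converges_def)
  then show thesis by (intro that[of "max N1 N2"]) auto
qed

lemma seq_converges_carrier:
  assumes "seq_converges R nrm x a"
  shows "x n \<in> carrier R" "a \<in> carrier R"
  using assms by (auto simp: seq_converges_def)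

lemma seq_converges_diff:
  assumes dense: "dense_hemiring TYPE('s)"
    and x: "seq_converges R nrm x a" and y: "seq_converges R nrm y b"
  shows "seq_converges R nrm (\<lambda>n. x n \<ominus> y n) (a \<ominus> b)"
  unfolding seq_converges_def
proof (intro conjI allI impI)
  note carr = seq_converges_carrier[OF x] seq_converges_carrier[OF y]
  show "x n \<ominus> y n \<in> carrier R" for n using carr by simp
  show "a \<ominus> b \<in> carrier R" using carr by simp
  fix \<epsilon> :: 's assume "\<epsilon> > 0"
  then obtain \<beta> \<gamma> :: 's where bg: "\<beta> > 0" "\<gamma> > 0" "\<beta> + \<gamma> < \<epsilon>"
    using dense by (auto simp: dense_hemiring_def)
  obtain N where N: "\<And>n. n \<ge> N \<Longrightarrow> nrm (x n \<ominus> a) < \<beta>" "\<And>n. n \<ge> N \<Longrightarrow> nrm (y n \<ominus> b) < \<gamma>"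
    using seq_converges_jointly[OF x y bg(1,2)] by blast
  have "nrm ((x n \<ominus> y n) \<ominus> (a \<ominus> b)) < \<epsilon>" if n: "n \<ge> N" for n
  proof -
    have "(x n \<ominus> y n) \<ominus> (a \<ominus> b) = (x n \<ominus> a) \<ominus> (y n \<ominus> b)"
      using carr by (simp add: minus_eq minus_add a_ac)
    then have "nrm ((x n \<ominus> y n) \<ominus> (a \<ominus> b)) \<le> nrm (x n \<ominus> a) + nrm (y n \<ominus> b)"
      using carr nrm_diff[of "x n \<ominus> a" "y n \<ominus> b"] by simp
    also have "\<dots> < \<beta> + \<gamma>" using N n by (intro add_strict_mono)
    finally show ?thesis using bg(3) by simp
  qed
  then show "\<exists>N. \<forall>n\<ge>N. nrm ((x n \<ominus> y n) \<ominus> (a \<ominus> b)) < \<epsilon>" by blast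
qed

lemma seq_converges_uminus:
  assumes "dense_hemiring TYPE('s)" "seq_converges R nrm x a"
  shows "seq_converges R nrm (\<lambda>n. \<ominus> x n) (\<ominus> a)"
  using seq_converges_diff[OF assms(1) seq_converges_const[OF zero_closed] assms(2)]
    seq_converges_carrier[OF assms(2)]
  by (simp add: minus_eq)

lemma seq_converges_add:
  assumes "dense_hemiring TYPE('s)" "seq_converges R nrm x a" "seq_converges R nrm y b"
  shows "seq_converges R nrm (\<lambda>n. x n \<oplus> y n) (a \<oplus> b)"
  using seq_converges_diff[OF assms(1,2) seq_converges_uminus[OF assms(1,3)]]
    seq_converges_carrier[OF assms(3)]
  by (simp add: minus_eq)

text \<open>The difference of two limits of the same sequence is the limit of the zero sequence, so its
  norm is below every positive element; were it nonzero, its norm would be below itself.\<close>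
lemma seq_converges_unique:
  assumes dense: "dense_hemiring TYPE('s)"
    and a: "seq_converges R nrm x a" and b: "seq_converges R nrm x b"
  shows "a = b"
proof -
  note carr = seq_converges_carrier[OF a] seq_converges_carrier[OF b]
  have "seq_converges R nrm (\<lambda>n. \<zero>) (b \<ominus> a)"
    using seq_converges_diff[OF dense b a] carr by (simp add: minus_eq r_neg)
  then have small: "nrm (\<zero> \<ominus> (b \<ominus> a)) < \<epsilon>" if "\<epsilon> > 0" for \<epsilon>
    using that by (auto simp: seq_converges_def)
  have "\<zero> \<ominus> (b \<ominus> a) = a \<ominus> b"
    using carr by (simp add: minus_eq minus_add a_ac)
  then have "\<not> 0 < nrm (a \<ominus> b)" using small[of "nrm (a \<ominus> b)"] by auto
  then have "nrm (a \<ominus> b) = 0" using nrm_nonneg[of "a \<ominus> b"] carr by (simp add: less_le)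
  then have zero: "a \<ominus> b = \<zero>" using carr by (simp add: nrm_eq_zero_iff)
  have "a = (a \<ominus> b) \<oplus> b" using carr by (simp add: minus_eq a_assoc l_neg)
  then show ?thesis using carr by (simp add: zero)
qed

lemma nrm_mult_diff_le:
  assumes "x \<in> carrier R" "y \<in> carrier R" "a \<in> carrier R" "b \<in> carrier R"
  shows "nrm (x \<otimes> y \<ominus> a \<otimes> b) \<le> nrm (x \<ominus> a) * nrm y + nrm a * nrm (y \<ominus> b)"
proof -
  have "x \<otimes> y \<ominus> a \<otimes> b = (x \<otimes> y \<ominus> a \<otimes> y) \<oplus> (a \<otimes> y \<ominus> a \<otimes> b)"
    using assms by (simp add: minus_eq mult_closed a_assoc r_neg1 l_neg)
  also have "\<dots> = (x \<ominus> a) \<otimes> y \<oplus> a \<otimes> (y \<ominus> b)"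
    using assms by (simp add: diff_distrib_left diff_distrib_right)
  also have "nrm \<dots> \<le> nrm ((x \<ominus> a) \<otimes> y) + nrm (a \<otimes> (y \<ominus> b))"
    using assms by (intro nrm_add) (auto intro: mult_closed)
  also have "\<dots> \<le> nrm (x \<ominus> a) * nrm y + nrm a * nrm (y \<ominus> b)"
    using assms by (intro add_mono nrm_mult) auto
  finally show ?thesis .
qed

lemma seq_converges_mult:
  assumes dense: "dense_hemiring TYPE('s)" and shrink: "shrinkable_hemiring TYPE('s)"
    and x: "seq_converges R nrm x a" and y: "seq_converges R nrm y b"
  shows "seq_converges R nrm (\<lambda>n. x n \<otimes> y n) (a \<otimes> b)"
  unfolding seq_converges_def
proof (intro conjI allI impI)
  note carr = seq_converges_carrier[OF x] seq_converges_carrier[OF y]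
  show "x n \<otimes> y n \<in> carrier R" for n using carr by (simp add: mult_closed)
  show "a \<otimes> b \<in> carrier R" using carr by (simp add: mult_closed)
  fix \<epsilon> :: 's assume e: "\<epsilon> > 0"
  then obtain \<beta> \<gamma> :: 's where bg: "\<beta> > 0" "\<gamma> > 0" "\<beta> + \<gamma> < \<epsilon>"
    using dense by (auto simp: dense_hemiring_def)
  \<comment> \<open>Adding \<open>\<epsilon>\<close> makes the bounds positive even if \<open>a\<close> or \<open>b\<close> is zero, as shrinkability needs;
    in the second one it also absorbs the distance of \<open>y n\<close> from \<open>b\<close>.\<close>
  have "nrm a + \<epsilon> > 0" "nrm b + \<epsilon> > 0"
    using e carr nrm_nonneg by (auto intro: add_nonneg_pos)
  then obtain \<alpha> \<delta> :: 's where
    al: "\<alpha> > 0" "\<alpha> * (nrm b + \<epsilon>) < \<beta>" and de: "\<delta> > 0" "(nrm a + \<epsilon>) * \<delta> < \<gamma>"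
    using shrink bg unfolding shrinkable_hemiring_def by meson
  obtain N1 where N1: "\<And>n. n \<ge> N1 \<Longrightarrow> nrm (x n \<ominus> a) < \<alpha>" "\<And>n. n \<ge> N1 \<Longrightarrow> nrm (y n \<ominus> b) < \<delta>"
    using seq_converges_jointly[OF x y al(1) de(1)] by blast
  obtain N2 where N2: "\<And>n. n \<ge> N2 \<Longrightarrow> nrm (y n \<ominus> b) < \<epsilon>"
    using seq_converges_jointly[OF x y e e] by blast
  have "nrm (x n \<otimes> y n \<ominus> a \<otimes> b) < \<epsilon>" if n: "n \<ge> max N1 N2" for n
  proof -
    have "nrm (y n) = nrm (b \<oplus> (y n \<ominus> b))"
      using carr by (simp add: minus_eq a_lcomm[of b "y n" "\<ominus> b"] r_neg)
    also have "\<dots> \<le> nrm b + nrm (y n \<ominus> b)" using carr by (intro nrm_add) auto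
    also have "\<dots> \<le> nrm b + \<epsilon>" using N2[of n] n by (simp add: less_imp_le)
    finally have bound: "nrm (y n) \<le> nrm b + \<epsilon>" .
    have "nrm (x n \<ominus> a) * nrm (y n) \<le> \<alpha> * (nrm b + \<epsilon>)"
      using N1(1)[of n] n bound al(1) carr nrm_nonneg
      by (intro mult_mono) (auto intro: less_imp_le)
    moreover have "nrm a * nrm (y n \<ominus> b) \<le> (nrm a + \<epsilon>) * \<delta>"
      using N1(2)[of n] n \<open>nrm a + \<epsilon> > 0\<close> e carr nrm_nonneg
      by (intro mult_mono) (auto intro: less_imp_le)
    ultimately have "nrm (x n \<ominus> a) * nrm (y n) + nrm a * nrm (y n \<ominus> b) < \<beta> + \<gamma>"
      using al(2) de(2) by (intro add_strict_mono) (auto intro: le_less_trans)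
    then show ?thesis
      using nrm_mult_diff_le[of "x n" "y n" a b] carr bg(3) by (auto intro: le_less_trans less_trans)
  qed
  then show "\<exists>N. \<forall>n\<ge>N. nrm (x n \<otimes> y n \<ominus> a \<otimes> b) < \<epsilon>" by blast
qed

lemma seq_lim_eq:
  assumes "dense_hemiring TYPE('s)" "seq_converges R nrm x a"
  shows "seq_lim R nrm x = a"
  unfolding seq_lim_def using assms seq_converges_unique by blast

section \<open>The ring of convergent sequences and the limit homomorphism\<close>

lemma nonunital_ring_Conv_ring:
  assumes dense: "dense_hemiring TYPE('s)" and shrink: "shrinkable_hemiring TYPE('s)"
  shows "nonunital_ring (Conv_ring R nrm)"
proof -
  have closed: "x n \<in> carrier R" if "x \<in> Conv R nrm" for x n
    using that seq_converges_carrier by (auto simp: Conv_def)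
  have "abelian_group (Conv_ring R nrm)"
  proof (rule abelian_groupI)
    show "\<exists>y\<in>carrier (Conv_ring R nrm). y \<oplus>\<^bsub>Conv_ring R nrm\<^esub> x = \<zero>\<^bsub>Conv_ring R nrm\<^esub>"
      if "x \<in> carrier (Conv_ring R nrm)" for x
    proof (rule bexI)
      show "(\<lambda>n. \<ominus> x n) \<in> carrier (Conv_ring R nrm)"
        using that seq_converges_uminus[OF dense] by (auto simp: Conv_ring_def Conv_def)
      show "(\<lambda>n. \<ominus> x n) \<oplus>\<^bsub>Conv_ring R nrm\<^esub> x = \<zero>\<^bsub>Conv_ring R nrm\<^esub>"
        using that closed by (simp add: Conv_ring_def l_neg)
    qed
  next
    show "x \<oplus>\<^bsub>Conv_ring R nrm\<^esub> y \<in> carrier (Conv_ring R nrm)"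
      if xy: "x \<in> carrier (Conv_ring R nrm)" "y \<in> carrier (Conv_ring R nrm)" for x y
    proof -
      obtain a b where "seq_converges R nrm x a" "seq_converges R nrm y b"
        using xy by (auto simp: Conv_ring_def Conv_def)
      from seq_converges_add[OF dense this] show ?thesis
        by (auto simp: Conv_ring_def Conv_def)
    qed
  next
    show "\<zero>\<^bsub>Conv_ring R nrm\<^esub> \<in> carrier (Conv_ring R nrm)"
      using seq_converges_const[OF zero_closed] by (auto simp: Conv_ring_def Conv_def)
  qed (auto simp: Conv_ring_def closed a_ac)
  moreover have "(\<lambda>n. x n \<otimes> y n) \<in> Conv R nrm" if "x \<in> Conv R nrm" "y \<in> Conv R nrm" for x y
    using that seq_converges_mult[OF dense shrink] unfolding Conv_def by blast
  ultimately show ?thesis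
    unfolding nonunital_ring_def nonunital_ring_axioms_def
    by (simp add: Conv_ring_def closed mult_assoc distrib_left distrib_right)
qed

lemma seq_lim_epi:
  assumes dense: "dense_hemiring TYPE('s)" and shrink: "shrinkable_hemiring TYPE('s)"
  shows "seq_lim R nrm \<in> nonunital_ring_epi (Conv_ring R nrm) R"
proof -
  note lim = seq_lim_eq[OF dense]
  have "seq_lim R nrm (\<lambda>n. x n \<oplus> y n) = seq_lim R nrm x \<oplus> seq_lim R nrm y"
    and "seq_lim R nrm (\<lambda>n. x n \<otimes> y n) = seq_lim R nrm x \<otimes> seq_lim R nrm y"
    if xy: "x \<in> Conv R nrm" "y \<in> Conv R nrm" for x y
  proof -
    obtain a b where ab: "seq_converges R nrm x a" "seq_converges R nrm y b"
      using xy by (auto simp: Conv_def)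
    show "seq_lim R nrm (\<lambda>n. x n \<oplus> y n) = seq_lim R nrm x \<oplus> seq_lim R nrm y"
      using lim[OF seq_converges_add[OF dense ab]] lim[OF ab(1)] lim[OF ab(2)] by simp
    show "seq_lim R nrm (\<lambda>n. x n \<otimes> y n) = seq_lim R nrm x \<otimes> seq_lim R nrm y"
      using lim[OF seq_converges_mult[OF dense shrink ab]] lim[OF ab(1)] lim[OF ab(2)] by simp
  qed
  moreover have into: "seq_lim R nrm x \<in> carrier R" if "x \<in> Conv R nrm" for x
    using that lim seq_converges_carrier(2) by (fastforce simp: Conv_def)
  moreover have "seq_lim R nrm ` Conv R nrm = carrier R"
  proof
    show "carrier R \<subseteq> seq_lim R nrm ` Conv R nrm"
    proof
      fix a assume "a \<in> carrier R"
      then have "seq_converges R nrm (\<lambda>n. a) a" by (rule seq_converges_const)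
      then show "a \<in> seq_lim R nrm ` Conv R nrm"
        using lim by (force simp: Conv_def)
    qed
  qed (use into in auto)
  ultimately show ?thesis
    by (simp add: nonunital_ring_epi_def nonunital_ring_hom_def Conv_ring_def)
qed

lemma kernel_seq_lim:
  assumes dense: "dense_hemiring TYPE('s)"
  shows "a_kernel (Conv_ring R nrm) R (seq_lim R nrm) = Zero_seqs R nrm"
  unfolding a_kernel_def' Zero_seqs_def Conv_ring_def Conv_def
  using seq_lim_eq[OF dense] by auto

lemma cring_Conv_ring:
  assumes dense: "dense_hemiring TYPE('s)" and shrink: "shrinkable_hemiring TYPE('s)"
    and R: "cring R"
  shows "cring (Conv_ring R nrm)"
proof -
  interpret cring R by (rule R)
  interpret C: nonunital_ring "Conv_ring R nrm"
    by (rule nonunital_ring_Conv_ring[OF dense shrink])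
  have closed: "x n \<in> carrier R" if "x \<in> carrier (Conv_ring R nrm)" for x n
    using that seq_converges_carrier by (auto simp: Conv_ring_def Conv_def)
  have "comm_monoid (Conv_ring R nrm)"
  proof (rule comm_monoidI)
    show "\<one>\<^bsub>Conv_ring R nrm\<^esub> \<in> carrier (Conv_ring R nrm)"
      using seq_converges_const[OF one_closed] by (auto simp: Conv_ring_def Conv_def)
    show "\<one>\<^bsub>Conv_ring R nrm\<^esub> \<otimes>\<^bsub>Conv_ring R nrm\<^esub> x = x"
      if "x \<in> carrier (Conv_ring R nrm)" for x
      using closed[OF that] by (simp add: Conv_ring_def)
    show "x \<otimes>\<^bsub>Conv_ring R nrm\<^esub> y = y \<otimes>\<^bsub>Conv_ring R nrm\<^esub> x"
      if "x \<in> carrier (Conv_ring R nrm)" "y \<in> carrier (Conv_ring R nrm)" for x y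
      using closed that by (simp add: Conv_ring_def m_comm)
  qed (rule C.mult_closed C.mult_assoc; assumption)+
  then show ?thesis
    by (intro cringI C.abelian_group_axioms C.distrib_right)
qed

lemma ring_hom_cring_seq_lim:
  assumes dense: "dense_hemiring TYPE('s)" and shrink: "shrinkable_hemiring TYPE('s)"
    and R: "cring R"
  shows "ring_hom_cring (Conv_ring R nrm) R (seq_lim R nrm)"
proof -
  have "\<one> \<in> carrier R" using R by (simp add: cring.cring_simprules)
  then have "seq_lim R nrm (\<lambda>n. \<one>) = \<one>"
    by (intro seq_lim_eq[OF dense] seq_converges_const)
  then have "seq_lim R nrm \<in> ring_hom (Conv_ring R nrm) R"
    using seq_lim_epi[OF dense shrink]
    by (auto simp: nonunital_ring_epi_def nonunital_ring_hom_def ring_hom_def Conv_ring_def)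
  then show ?thesis
    using cring_Conv_ring[OF dense shrink R] R
    by (simp add: ring_hom_cring_def ring_hom_cring_axioms_def)
qed

end

theorem theorem2p11:
  fixes R :: "('a, 'm) ring_scheme"
    and nrm :: "'a \<Rightarrow> 's::{ordered_ring, semilattice_sup}"
  assumes "pseudonormed_ring R nrm"
    and "dense_hemiring TYPE('s)"
    and "shrinkable_hemiring TYPE('s)"
  shows
    "(\<forall>x y a b. seq_converges R nrm x a \<and> seq_converges R nrm y b \<longrightarrow>
        seq_converges R nrm (\<lambda>n. x n \<otimes>\<^bsub>R\<^esub> y n) (a \<otimes>\<^bsub>R\<^esub> b)) \<and>
     (nonunital_ring (Conv_ring R nrm) \<and>
      (\<forall>x\<in>Conv R nrm. \<exists>!a. seq_converges R nrm x a) \<and>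
      seq_lim R nrm \<in> nonunital_ring_epi (Conv_ring R nrm) R \<and>
      a_kernel (Conv_ring R nrm) R (seq_lim R nrm) = Zero_seqs R nrm) \<and>
     (cring R \<longrightarrow>
        ideal (Zero_seqs R nrm) (Conv_ring R nrm) \<and>
        (primeideal (Zero_seqs R nrm) (Conv_ring R nrm) \<longleftrightarrow> domain R) \<and>
        (maximalideal (Zero_seqs R nrm) (Conv_ring R nrm) \<longleftrightarrow> field R))"
proof -
  interpret pseudonormed_ring R nrm by (rule assms(1))
  note ds = assms(2,3)
  have unique: "\<forall>x\<in>Conv R nrm. \<exists>!a. seq_converges R nrm x a"
    using seq_converges_unique[OF ds(1)] by (auto simp: Conv_def)
  have comm: "ideal (Zero_seqs R nrm) (Conv_ring R nrm) \<and>
      (primeideal (Zero_seqs R nrm) (Conv_ring R nrm) \<longleftrightarrow> domain R) \<and>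
      (maximalideal (Zero_seqs R nrm) (Conv_ring R nrm) \<longleftrightarrow> field R)" if R: "cring R"
  proof -
    interpret lim: ring_hom_cring "Conv_ring R nrm" R "seq_lim R nrm"
      by (rule ring_hom_cring_seq_lim[OF ds R])
    have "ideal (Zero_seqs R nrm) (Conv_ring R nrm)"
      using lim.ring.kernel_is_ideal kernel_seq_lim[OF ds(1)] by simp
    moreover have "seq_lim R nrm ` carrier (Conv_ring R nrm) = carrier R"
      using seq_lim_epi[OF ds] by (simp add: nonunital_ring_epi_def)
    ultimately show ?thesis
      using lim.kernel_prime_iff_domain lim.kernel_maximal_iff_field kernel_seq_lim[OF ds(1)]
      by simp
  qed
  show ?thesis
    using seq_converges_mult[OF ds] nonunital_ring_Conv_ring[OF ds] unique seq_lim_epi[OF ds]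
      kernel_seq_lim[OF ds(1)] comm by blast
qed

end
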